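(* Let $x$ be a complex number and $n\ge 2$ an integer such that all quantities below are defined. Then \[ \sum_{k=0}^n\binom{2n-k}{n}\binom{x+k}{k}k^2H_{k}^{\langle2\rangle}(x)=\frac{(x+1)(xn+3n+1)}{8(n-1)}\binom{x+2n+1}{n-2} \Big\{4H_{2n+1}^{\langle2\rangle}(x)+\tfrac{8(x^2+3x+n^2-n+1)}{n(x+1)(xn+3n+1)} -\big[H_n(\tfrac{x}{2})-H_{n+1}(\tfrac{x-1}{2})\big] \big[H_n(\tfrac{x}{2})-H_{n+1}(\tfrac{x-1}{2})-\tfrac{4(x+n+1)(x^2+3x-2n+1)}{n(x+1)(xn+3n+1)}\big]\Big\}. \]
   Context: For a complex $y$ and an integer $k\ge 0$, $\binom{y}{k}=\frac{y(y-1)\cdots(y-k+1)}{k!}$. For complex $x$, integer $n\ge 0$ and positive integer $\ell$: $H_0^{\langle\ell\rangle}(x)=0$, $H_n^{\langle\ell\rangle}(x)=\sum_{k=1}^n\frac{1}{(x+k)^\ell}$, and $H_n(x)=H_n^{\langle1\rangle}(x)$. *)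

theory Defs
  imports Complex_Main
begin

definition gen_harm :: "nat \<Rightarrow> nat \<Rightarrow> complex \<Rightarrow> complex" where
  "gen_harm l n x = (\<Sum>k=1..n. 1 / (x + of_nat k) ^ l)"

end

theory Submission
  imports Defs
begin

text \<open>
  Write \<open>f\<^sub>n(k) = binom(2n - k, n) binom(x + k, k)\<close>,
  \<open>S\<^sub>n = \<Sum>\<^sub>k f\<^sub>n(k) = binom(x + 2n + 1, n)\<close> and \<open>D\<^sub>n = H\<^sub>n(x/2) - H\<^sub>n\<^sub>+\<^sub>1((x-1)/2)\<close>.
  With \<open>M = x + n + 2\<close> and \<open>N = x + 2n + 3\<close>, creative telescoping gives
  \<open>(n+1) M f\<^sub>n\<^sub>+\<^sub>1(k) - N (N-1) f\<^sub>n(k) = g(k+1) - g(k)\<close> with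
  \<open>g(k+1) = -(x+k+1) (x+k+2) f\<^sub>n(k)\<close>, and the left-hand side is moreover divisible by \<open>x+k+1\<close>.
  Dividing by \<open>x+k+1\<close> and summing gives \<open>\<Sum>\<^sub>k f\<^sub>n(k) / (x+k+1) = - S\<^sub>n D\<^sub>n / 2\<close> by induction on \<open>n\<close>;
  multiplying by the second order harmonic number \<open>H\<^sub>k\<close> and summing by parts then gives
  \<open>\<Sum>\<^sub>k f\<^sub>n(k) H\<^sub>k = S\<^sub>n (4 H\<^sub>2\<^sub>n\<^sub>+\<^sub>1 - D\<^sub>n\<^sup>2) / 8\<close>.
  The weights \<open>k\<close> and \<open>k\<^sup>2\<close> are reduced to these sums by summing by parts the forward difference
  of \<open>k (2n+1-k) f\<^sub>n(k) q(k)\<close> for \<open>q(k) = 1\<close> and \<open>q(k) = k\<close>.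
\<close>

section \<open>Contiguity relations and the convolution sum of the two binomials\<close>

text \<open>The guard matters: with truncated subtraction, \<open>(m + p - k) choose m\<close> is \<open>1\<close> for \<open>m = 0\<close>, \<open>k > p\<close>.\<close>

definition conv_term :: "complex \<Rightarrow> nat \<Rightarrow> nat \<Rightarrow> nat \<Rightarrow> complex" where
  "conv_term x m p k =
     (if k \<le> p then of_nat ((m + p - k) choose m) * ((x + of_nat k) gchoose k) else 0)"

lemma conv_term_eq_0: "k > p \<Longrightarrow> conv_term x m p k = 0"
  by (simp add: conv_term_def)

text \<open>Absorption in the first binomial: (N - m) binom(N, m) = N binom(N-1, m) with N = m + p +
  1 - k. At k = p + 1 the guard annihilates the left side and the factor p + 1 - k the right side,
  so the relation holds for every k.\<close>

lemma conv_term_Suc_right: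
  "(of_nat m + of_nat p + 1 - of_nat k) * conv_term x m p k
     = (of_nat p + 1 - of_nat k) * conv_term x m (Suc p) k"
proof (cases "k \<le> p")
  case True
  have "(Suc (m + p) - k - m) * ((Suc (m + p) - k) choose m)
          = (Suc (m + p) - k) * ((m + p - k) choose m)"
    using binomial_absorb_comp[of "Suc (m + p) - k" m] by simp
  also have "Suc (m + p) - k - m = Suc p - k"
    using True by simp
  finally have "of_nat ((Suc p - k) * ((Suc (m + p) - k) choose m))
      = (of_nat ((Suc (m + p) - k) * ((m + p - k) choose m)) :: complex)"
    by simp
  with True show ?thesis
    by (simp add: conv_term_def of_nat_diff add_ac del: of_nat_Suc)
       (simp add: algebra_simps)
next
  case False
  then show ?thesis
    by (cases "k = Suc p") (simp_all add: conv_term_def)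
qed

lemma conv_term_Suc_left:
  "of_nat (Suc m) * conv_term x (Suc m) p k
     = (of_nat m + of_nat p + 1 - of_nat k) * conv_term x m p k"
proof (cases "k \<le> p")
  case True
  have "Suc m * ((Suc (m + p - k)) choose Suc m) = Suc (m + p - k) * ((m + p - k) choose m)"
    by (rule Suc_times_binomial)
  moreover have "Suc (m + p - k) = Suc m + p - k"
    using True by simp
  ultimately have "of_nat (Suc m * ((Suc m + p - k) choose Suc m))
      = (of_nat ((Suc m + p - k) * ((m + p - k) choose m)) :: complex)"
    by simp
  then have "of_nat (Suc m) * of_nat ((Suc m + p - k) choose Suc m)
      = (of_nat m + of_nat p + 1 - of_nat k) * (of_nat ((m + p - k) choose m) :: complex)"
    unfolding of_nat_mult using True by (simp add: of_nat_diff algebra_simps)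
  with True show ?thesis
    by (simp add: conv_term_def mult.assoc[symmetric] del: of_nat_Suc)
qed (simp add: conv_term_def)

text \<open>Raising k and p together leaves m + p - k, hence the first binomial, unchanged; only
  absorption in the second binomial remains. This turns values at k + 1 into values at k in all
  telescoping below.\<close>

lemma conv_term_Suc_Suc:
  "of_nat (Suc k) * conv_term x m (Suc p) (Suc k) = (x + of_nat k + 1) * conv_term x m p k"
  using Suc_times_gbinomial[of k "x + of_nat k"]
  by (simp add: conv_term_def add_ac)

text \<open>Both sides are the coefficient of z^p in (1-z)^(-m-1) (1-z)^(-x-1) = (1-z)^(-x-m-2). The
  proof applies Pascal's rule to each side, with parallel summation as the boundary case m =
  0.\<close>

lemma sum_conv_term: "(\<Sum>k\<le>p. conv_term x m p k) = ((x + of_nat m + of_nat p + 1) gchoose p)"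
proof (induction "m + p" arbitrary: m p)
  case 0
  then show ?case by (simp add: conv_term_def)
next
  case (Suc s)
  show ?case
  proof (cases p)
    case 0
    then show ?thesis by (simp add: conv_term_def)
  next
    case p: (Suc q)
    show ?thesis
    proof (cases m)
      case 0
      then show ?thesis
        using gbinomial_parallel_sum[of x p] by (simp add: conv_term_def add_ac)
    next
      case m: (Suc l)
      have pascal: "conv_term x (Suc l) (Suc q) k
          = conv_term x l (Suc q) k + conv_term x (Suc l) q k" if "k \<le> Suc q" for k
      proof (cases "k = Suc q")
        case False
        with that have "Suc l + Suc q - k = Suc (l + Suc q - k)" "l + Suc q - k = Suc l + q - k"
          by auto
        with that False show ?thesis
          by (simp add: conv_term_def algebra_simps)
      qed (simp add: conv_term_def)
      have "(\<Sum>k\<le>p. conv_term x m p k)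
          = (\<Sum>k\<le>Suc q. conv_term x l (Suc q) k) + (\<Sum>k\<le>q. conv_term x (Suc l) q k)"
        unfolding p m by (subst sum.cong[OF refl pascal]) (auto simp: sum.distrib conv_term_eq_0)
      also have "\<dots> = ((x + of_nat l + of_nat (Suc q) + 1) gchoose Suc q)
          + ((x + of_nat (Suc l) + of_nat q + 1) gchoose q)"
        using Suc.hyps(1)[of l "Suc q"] Suc.hyps(1)[of "Suc l" q] Suc.hyps(2)
        unfolding p m by (simp del: sum.atMost_Suc)
      also have "\<dots> = ((x + of_nat m + of_nat p + 1) gchoose p)"
        using gbinomial_Suc_Suc[of "x + of_nat l + of_nat q + 2" q]
        unfolding p m by (simp add: add_ac)
      finally show ?thesis .
    qed
  qed
qed

section \<open>Harmonic sums: summation by parts and the alternating sum\<close>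

lemma gen_harm_0 [simp]: "gen_harm l 0 x = 0"
  by (simp add: gen_harm_def)

lemma gen_harm_Suc: "gen_harm l (Suc n) x = gen_harm l n x + 1 / (x + of_nat (Suc n)) ^ l"
  by (simp add: gen_harm_def)

lemma gen_harm_sum_by_parts:
  "(\<Sum>k<m. gen_harm 2 k x * (g (Suc k) - g k))
     = gen_harm 2 m x * g m - (\<Sum>k<m. g (Suc k) / (x + of_nat k + 1) ^ 2)"
  by (induction m) (simp_all add: gen_harm_Suc algebra_simps)

text \<open>This is twice the sum of (-1)^j / (x + j) over j = 1, ..., 2n + 1: the first harmonic
  number collects the even j, the second the odd j.\<close>

definition alt_harm :: "complex \<Rightarrow> nat \<Rightarrow> complex" where
  "alt_harm x n = gen_harm 1 n (x / 2) - gen_harm 1 (n + 1) ((x - 1) / 2)"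

lemma alt_harm_0: "alt_harm x 0 = - 2 / (x + 1)"
proof -
  have "(x - 1) / 2 + 1 = (x + 1) / 2"
    by (simp add: field_simps)
  then have "1 / ((x - 1) / 2 + 1) = 2 / (x + 1)"
    by (simp only: divide_divide_eq_right mult_1)
  then show ?thesis
    by (simp add: alt_harm_def gen_harm_def)
qed

lemma alt_harm_Suc:
  "alt_harm x (Suc n) = alt_harm x n + 2 / (x + 2 * of_nat n + 2) - 2 / (x + 2 * of_nat n + 3)"
proof -
  have "x / 2 + of_nat (Suc n) = (x + 2 * of_nat n + 2) / 2"
    "(x - 1) / 2 + of_nat (Suc (Suc n)) = (x + 2 * of_nat n + 3) / 2"
    by (simp_all add: field_simps)
  \<comment> \<open>Since division by 0 gives 0, clearing the inner denominators is valid for every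
    x.\<close>
  then have "1 / (x / 2 + of_nat (Suc n)) = 2 / (x + 2 * of_nat n + 2)"
    "1 / ((x - 1) / 2 + of_nat (Suc (Suc n))) = 2 / (x + 2 * of_nat n + 3)"
    by (simp_all only: divide_divide_eq_right mult_1)
  then show ?thesis
    by (simp add: alt_harm_def gen_harm_Suc del: of_nat_Suc)
qed

section \<open>The diagonal m = p = n: recurrences in n by creative telescoping\<close>

text \<open>Two absorptions through binom(x + 2n + 2, n). The coefficients are those of the creative
  telescoping relation, so S_n solves its homogeneous recurrence and each closed form is S_n times a
  factor with a simple increment.\<close>

lemma gbinomial_central_Suc:
  fixes x :: complex
  shows "of_nat (Suc n) * (x + of_nat n + 2) * ((x + 2 * of_nat (Suc n) + 1) gchoose Suc n)
    = (x + 2 * of_nat n + 3) * (x + 2 * of_nat n + 2) * ((x + 2 * of_nat n + 1) gchoose n)"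
proof -
  have 1: "of_nat (Suc n) * ((x + 2 * of_nat (Suc n) + 1) gchoose Suc n)
      = (x + 2 * of_nat n + 3) * ((x + 2 * of_nat n + 2) gchoose n)"
    using Suc_times_gbinomial[of n "x + 2 * of_nat n + 2"] by (simp add: algebra_simps)
  have 2: "(x + of_nat n + 2) * ((x + 2 * of_nat n + 2) gchoose n)
      = (x + 2 * of_nat n + 2) * ((x + 2 * of_nat n + 1) gchoose n)"
    using gbinomial_absorb_comp[of "x + 2 * of_nat n + 2" n] by (simp add: algebra_simps)
  have "of_nat (Suc n) * (x + of_nat n + 2) * ((x + 2 * of_nat (Suc n) + 1) gchoose Suc n)
      = (x + of_nat n + 2) * (of_nat (Suc n) * ((x + 2 * of_nat (Suc n) + 1) gchoose Suc n))"
    by (simp only: mult_ac)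
  also have "\<dots> = (x + 2 * of_nat n + 3) * ((x + of_nat n + 2) * ((x + 2 * of_nat n + 2) gchoose n))"
    unfolding 1 by (simp only: mult_ac)
  also have "\<dots> = (x + 2 * of_nat n + 3) * (x + 2 * of_nat n + 2) * ((x + 2 * of_nat n + 1) gchoose n)"
    unfolding 2 by (simp only: mult_ac)
  finally show ?thesis .
qed

lemma sum_conv_term_diag:
  "(\<Sum>k\<le>n. conv_term x n n k) = ((x + 2 * of_nat n + 1) gchoose n)"
  using sum_conv_term[of x n n] by (simp add: algebra_simps)

text \<open>The rows n + 1 and n are both compared with the intermediate term for (n, n + 1); the
  claim is a linear combination of the two contiguity relations. The exposed factor x + k + 1 is
  what makes the sum weighted by 1 / (x + k + 1) computable.\<close>

lemma conv_term_step:
  "of_nat (Suc n) * (x + of_nat n + 2) * conv_term x (Suc n) (Suc n) k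
     - (x + 2 * of_nat n + 3) * (x + 2 * of_nat n + 2) * conv_term x n n k
   = (x + of_nat k + 1) * (of_nat (Suc n) * conv_term x n (Suc n) k
       - (x + 2 * of_nat n + 3) * conv_term x n n k)"
proof -
  define F C F' where "F = conv_term x n n k" and "C = conv_term x n (Suc n) k"
    and "F' = conv_term x (Suc n) (Suc n) k"
  have 1: "(2 * of_nat n + 1 - of_nat k) * F = (of_nat n + 1 - of_nat k) * C"
    using conv_term_Suc_right[of n n k x] by (simp add: F_def C_def algebra_simps)
  have 2: "of_nat (Suc n) * F' = (2 * of_nat n + 2 - of_nat k) * C"
    using conv_term_Suc_left[of n x "Suc n" k] by (simp add: F'_def C_def algebra_simps)
  have "of_nat (Suc n) * (x + of_nat n + 2) * F'
      - (x + 2 * of_nat n + 3) * (x + 2 * of_nat n + 2) * F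
      - (x + of_nat k + 1) * (of_nat (Suc n) * C - (x + 2 * of_nat n + 3) * F)
    = (x + of_nat n + 2) * (of_nat (Suc n) * F' - (2 * of_nat n + 2 - of_nat k) * C)
      - (x + 2 * of_nat n + 3)
        * ((2 * of_nat n + 1 - of_nat k) * F - (of_nat n + 1 - of_nat k) * C)"
    by (simp add: algebra_simps)
  then show ?thesis
    unfolding 1 2 by (simp add: F_def C_def F'_def)
qed

text \<open>The certificate is written as -k (x+k+1) times the intermediate term, which vanishes at
  k = 0 by its factor k and for k > n + 1 by the guard, without any index k - 1.\<close>

lemma conv_term_telescope:
  "of_nat (Suc n) * (x + of_nat n + 2) * conv_term x (Suc n) (Suc n) k
     - (x + 2 * of_nat n + 3) * (x + 2 * of_nat n + 2) * conv_term x n n k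
   = - (of_nat (Suc k) * (x + of_nat (Suc k) + 1) * conv_term x n (Suc n) (Suc k))
     - - (of_nat k * (x + of_nat k + 1) * conv_term x n (Suc n) k)"
proof -
  define F C C' where "F = conv_term x n n k" and "C = conv_term x n (Suc n) k"
    and "C' = conv_term x n (Suc n) (Suc k)"
  have 1: "(2 * of_nat n + 1 - of_nat k) * F = (of_nat n + 1 - of_nat k) * C"
    using conv_term_Suc_right[of n n k x] by (simp add: F_def C_def algebra_simps)
  have 2: "of_nat (Suc k) * C' = (x + of_nat k + 1) * F"
    using conv_term_Suc_Suc[of k x n n] by (simp add: F_def C'_def)
  have "(x + of_nat k + 1) * (of_nat (Suc n) * C - (x + 2 * of_nat n + 3) * F)
      - (- (of_nat (Suc k) * (x + of_nat (Suc k) + 1) * C') - - (of_nat k * (x + of_nat k + 1) * C))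
    = (x + of_nat k + 2) * (of_nat (Suc k) * C' - (x + of_nat k + 1) * F)
      - (x + of_nat k + 1)
        * ((2 * of_nat n + 1 - of_nat k) * F - (of_nat n + 1 - of_nat k) * C)"
    by (simp add: algebra_simps)
  then show ?thesis
    unfolding conv_term_step 1 2 by (simp add: F_def C_def C'_def)
qed

lemma sum_conv_term_divide:
  assumes "\<And>k. k \<in> {1..2 * n + 1} \<Longrightarrow> x + of_nat k \<noteq> 0"
  shows "(\<Sum>k\<le>n. conv_term x n n k / (x + of_nat k + 1))
     = - ((x + 2 * of_nat n + 1) gchoose n) * alt_harm x n / 2"
  using assms
proof (induction n)
  case 0
  have "- (- 2 / w) / 2 = 1 / w" for w :: complex
    by simp
  from this[of "x + 1"] show ?case
    by (simp only: alt_harm_0) (simp add: conv_term_def)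
next
  case (Suc n)
  define N where "N = x + 2 * of_nat n + 3"
  define M where "M = x + of_nat n + 2"
  define S where "S = ((x + 2 * of_nat n + 1) gchoose n)"
  define S' where "S' = ((x + 2 * of_nat (Suc n) + 1) gchoose Suc n)"
  define E where "E = (\<Sum>k\<le>n. conv_term x n n k / (x + of_nat k + 1))"
  define E' where "E' = (\<Sum>k\<le>Suc n. conv_term x (Suc n) (Suc n) k / (x + of_nat k + 1))"
  define c :: complex where "c = of_nat (Suc n)"
  have nz: "N \<noteq> 0" "N - 1 \<noteq> 0" "M \<noteq> 0" "c \<noteq> 0"
    using Suc.prems[of "2 * n + 3"] Suc.prems[of "2 * n + 2"] Suc.prems[of "n + 2"]
    unfolding N_def M_def c_def of_nat_eq_0_iff by (simp_all add: add_ac)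
  have xk: "x + of_nat k + 1 \<noteq> 0" if "k \<le> Suc n" for k
    using Suc.prems[of "Suc k"] that by (simp add: algebra_simps)
  have IH: "E = - S * alt_harm x n / 2"
    unfolding E_def S_def using Suc.IH Suc.prems by simp
  \<comment> \<open>The intermediate row sums to binom(x + 2n + 2, n + 1), and absorption reduces
    this to S.\<close>
  have T: "c * (\<Sum>k\<le>Suc n. conv_term x n (Suc n) k) = (N - 1) * S"
  proof -
    have "c * ((x + 2 * of_nat n + 2) gchoose Suc n) = (N - 1) * S"
      using Suc_times_gbinomial[of n "x + 2 * of_nat n + 1"]
      unfolding c_def N_def S_def by (simp add: algebra_simps)
    then show ?thesis
      using sum_conv_term[of x n "Suc n"] by (simp add: algebra_simps)
  qed
  have "c * M * E' - N * (N - 1) * E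
      = (\<Sum>k\<le>Suc n. (c * M * conv_term x (Suc n) (Suc n) k
           - N * (N - 1) * conv_term x n n k) / (x + of_nat k + 1))"
  proof -
    have "E = (\<Sum>k\<le>Suc n. conv_term x n n k / (x + of_nat k + 1))"
      by (simp add: E_def conv_term_eq_0)
    then show ?thesis
      unfolding E'_def
      by (simp only: sum_distrib_left sum_subtractf[symmetric] diff_divide_distrib
          times_divide_eq_right)
  qed
  also have "\<dots> = (\<Sum>k\<le>Suc n. c * conv_term x n (Suc n) k - N * conv_term x n n k)"
  proof (rule sum.cong[OF refl])
    fix k assume "k \<in> {..Suc n}"
    then have "x + of_nat k + 1 \<noteq> 0"
      using xk by simp
    moreover have "N - 1 = x + 2 * of_nat n + 2"
      by (simp add: N_def)
    ultimately show "(c * M * conv_term x (Suc n) (Suc n) k - N * (N - 1) * conv_term x n n k)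
        / (x + of_nat k + 1) = c * conv_term x n (Suc n) k - N * conv_term x n n k"
      unfolding c_def M_def by (simp only: N_def conv_term_step) simp
  qed
  also have "\<dots> = (N - 1) * S - N * S"
    using T sum_conv_term_diag[of x n]
    by (simp add: sum_subtractf sum_distrib_left[symmetric] conv_term_eq_0 S_def)
  finally have rec: "c * M * E' = N * (N - 1) * E - S"
    by (simp add: algebra_simps)
  have SS: "c * M * S' = N * (N - 1) * S"
    using gbinomial_central_Suc[of n x] unfolding c_def M_def N_def S_def S'_def
    by (simp add: algebra_simps)
  \<comment> \<open>Because S' absorbs the homogeneous part, \<open>alt_harm\<close> has to grow by
    2t with N (N-1) t = 1; the partial fraction 1/(N-1) - 1/N shows that it does.\<close>
  define t where "t = 1 / (N * (N - 1))"
  have t: "N * (N - 1) * t = 1" "1 / (N - 1) - 1 / N = t"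
    unfolding t_def using nz by (simp_all add: diff_frac_eq mult.commute)
  have D: "alt_harm x (Suc n) = alt_harm x n + 2 * t"
    unfolding alt_harm_Suc t(2)[symmetric] N_def by (simp add: algebra_simps)
  have "c * M * (- S' * alt_harm x (Suc n) / 2) = - (c * M * S') * alt_harm x (Suc n) / 2"
    by simp
  also have "\<dots> = N * (N - 1) * E - (N * (N - 1) * t) * S"
    unfolding SS D IH by (simp add: field_simps)
  finally have "c * M * E' = c * M * (- S' * alt_harm x (Suc n) / 2)"
    using rec t(1) by simp
  then have "E' = - S' * alt_harm x (Suc n) / 2"
    using nz by (simp only: mult_cancel_left mult_eq_0_iff) blast
  then show ?case
    unfolding E'_def S'_def .
qed

text \<open>Summing \<open>conv_term_telescope\<close> by parts against the harmonic numbers leaves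
  a first-order recurrence with inhomogeneity S + E, where E is known from
  \<open>sum_conv_term_divide\<close>.\<close>

lemma sum_conv_term_harm:
  assumes "\<And>k. k \<in> {1..2 * n + 1} \<Longrightarrow> x + of_nat k \<noteq> 0"
  shows "(\<Sum>k\<le>n. conv_term x n n k * gen_harm 2 k x)
     = ((x + 2 * of_nat n + 1) gchoose n) * (4 * gen_harm 2 (2 * n + 1) x - alt_harm x n ^ 2) / 8"
  using assms
proof (induction n)
  case 0
  then show ?case
    by (simp add: alt_harm_0 gen_harm_def power_divide)
next
  case (Suc n)
  define N where "N = x + 2 * of_nat n + 3"
  define M where "M = x + of_nat n + 2"
  define S where "S = ((x + 2 * of_nat n + 1) gchoose n)"
  define S' where "S' = ((x + 2 * of_nat (Suc n) + 1) gchoose Suc n)"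
  define E where "E = (\<Sum>k\<le>n. conv_term x n n k / (x + of_nat k + 1))"
  define A where "A = (\<Sum>k\<le>n. conv_term x n n k * gen_harm 2 k x)"
  define A' where "A' = (\<Sum>k\<le>Suc n. conv_term x (Suc n) (Suc n) k * gen_harm 2 k x)"
  define c :: complex where "c = of_nat (Suc n)"
  define d where "d = alt_harm x n"
  define h where "h = gen_harm 2 (2 * n + 1) x"
  have nz: "N \<noteq> 0" "N - 1 \<noteq> 0" "M \<noteq> 0" "c \<noteq> 0"
    using Suc.prems[of "2 * n + 3"] Suc.prems[of "2 * n + 2"] Suc.prems[of "n + 2"]
    unfolding N_def M_def c_def of_nat_eq_0_iff by (simp_all add: add_ac)
  have IH: "A = S * (4 * h - d ^ 2) / 8"
    unfolding A_def S_def h_def d_def using Suc.IH Suc.prems by simp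
  have E: "E = - S * d / 2"
    unfolding E_def S_def d_def using sum_conv_term_divide[of n x] Suc.prems by simp
  define g where "g k = - (of_nat k * (x + of_nat k + 1) * conv_term x n (Suc n) k)" for k
  have g_Suc: "g (Suc k) = - ((x + of_nat k + 1) * (x + of_nat k + 2) * conv_term x n n k)" for k
    using conv_term_Suc_Suc[of k x n n] unfolding g_def of_nat_Suc by algebra
  have "c * M * A' - N * (N - 1) * A
      = (\<Sum>k<n + 2. gen_harm 2 k x * (c * M * conv_term x (Suc n) (Suc n) k
           - N * (N - 1) * conv_term x n n k))"
  proof -
    have "A = (\<Sum>k<n + 2. conv_term x n n k * gen_harm 2 k x)"
      "A' = (\<Sum>k<n + 2. conv_term x (Suc n) (Suc n) k * gen_harm 2 k x)"
      by (simp_all add: A_def A'_def conv_term_eq_0 lessThan_Suc_atMost)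
    then show ?thesis
      by (simp only: sum_distrib_left sum_subtractf[symmetric] right_diff_distrib mult_ac)
  qed
  also have "\<dots> = (\<Sum>k<n + 2. gen_harm 2 k x * (g (Suc k) - g k))"
  proof (rule sum.cong[OF refl])
    fix k
    have "N - 1 = x + 2 * of_nat n + 2"
      by (simp add: N_def)
    then show "gen_harm 2 k x * (c * M * conv_term x (Suc n) (Suc n) k
        - N * (N - 1) * conv_term x n n k) = gen_harm 2 k x * (g (Suc k) - g k)"
      using conv_term_telescope[of n x k]
      by (simp only: c_def M_def g_def N_def)
  qed
  \<comment> \<open>The boundary term vanishes because g(n + 2) = 0 by the guard.\<close>
  also have "\<dots> = - (\<Sum>k<n + 2. g (Suc k) / (x + of_nat k + 1) ^ 2)"
    unfolding gen_harm_sum_by_parts by (simp add: g_def conv_term_eq_0)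
  also have "\<dots> = - (\<Sum>k\<le>n. g (Suc k) / (x + of_nat k + 1) ^ 2)"
    by (simp add: g_Suc conv_term_eq_0 lessThan_Suc_atMost)
  \<comment> \<open>One factor x + k + 1 cancels, and (x+k+2) / (x+k+1) = 1 + 1 / (x+k+1).\<close>
  also have "\<dots> = (\<Sum>k\<le>n. conv_term x n n k + conv_term x n n k / (x + of_nat k + 1))"
    unfolding sum_negf[symmetric]
  proof (rule sum.cong[OF refl])
    fix k assume "k \<in> {..n}"
    then have "x + of_nat k + 1 \<noteq> 0"
      using Suc.prems[of "Suc k"] by (simp add: algebra_simps)
    then show "- (g (Suc k) / (x + of_nat k + 1) ^ 2)
        = conv_term x n n k + conv_term x n n k / (x + of_nat k + 1)"
      unfolding g_Suc by (simp add: divide_simps power2_eq_square) (simp add: algebra_simps)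
  qed
  also have "\<dots> = S + E"
    by (simp add: sum.distrib sum_conv_term_diag S_def E_def)
  finally have rec: "c * M * A' = N * (N - 1) * A + S + E"
    by (simp add: algebra_simps)
  have SS: "c * M * S' = N * (N - 1) * S"
    using gbinomial_central_Suc[of n x] unfolding c_def M_def N_def S_def S'_def
    by (simp add: algebra_simps)
  define t where "t = 1 / (N * (N - 1))"
  have t: "N * (N - 1) * t = 1" "1 / (N - 1) - 1 / N = t"
    unfolding t_def using nz by (simp_all add: diff_frac_eq mult.commute)
  have D: "alt_harm x (Suc n) = d + 2 * t"
    unfolding alt_harm_Suc t(2)[symmetric] N_def d_def by (simp add: algebra_simps)
  \<comment> \<open>In 4H - D^2 the increment 4t^2 cancels against (2t)^2, leaving 8t - 4dt, which
    accounts exactly for S + E.\<close>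
  have H: "gen_harm 2 (2 * Suc n + 1) x = h + t ^ 2 + 2 * t"
  proof -
    have "2 * Suc n + 1 = Suc (Suc (2 * n + 1))" by simp
    then have "gen_harm 2 (2 * Suc n + 1) x = h + 1 / (N - 1) ^ 2 + 1 / N ^ 2"
      unfolding h_def N_def by (simp only: gen_harm_Suc) (simp add: algebra_simps)
    also have "\<dots> = h + (1 / (N - 1) - 1 / N) ^ 2 + 2 * t"
      unfolding t_def by (simp add: power2_diff power_divide)
    finally show ?thesis
      unfolding t(2) .
  qed
  have "c * M * (S' * (4 * gen_harm 2 (2 * Suc n + 1) x - alt_harm x (Suc n) ^ 2) / 8)
      = (c * M * S') * (4 * gen_harm 2 (2 * Suc n + 1) x - alt_harm x (Suc n) ^ 2) / 8"
    by simp
  also have "\<dots> = N * (N - 1) * A + (N * (N - 1) * t) * (S + E)"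
    unfolding SS D H IH E by (simp add: field_simps power2_eq_square)
  finally have "c * M * A'
      = c * M * (S' * (4 * gen_harm 2 (2 * Suc n + 1) x - alt_harm x (Suc n) ^ 2) / 8)"
    using rec t(1) by simp
  then have "A' = S' * (4 * gen_harm 2 (2 * Suc n + 1) x - alt_harm x (Suc n) ^ 2) / 8"
    using nz by simp
  then show ?case
    unfolding A'_def S'_def .
qed

section \<open>Reduction of polynomial weights in k\<close>

text \<open>By \<open>conv_term_Suc_right\<close>, G(k) is k (2n+1-k) f_n(k) q(k). Writing it with
  the intermediate term makes the shift to k + 1 immediate, and the factor n + 1 - k makes G vanish
  at the upper end k = n + 1.\<close>

lemma conv_term_weight_telescope:
  fixes x :: complex and q :: "nat \<Rightarrow> complex" and n :: nat
  defines "G \<equiv> \<lambda>k. of_nat k * (of_nat n + 1 - of_nat k) * conv_term x n (Suc n) k * q k"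
  shows "G (Suc k) = (of_nat n - of_nat k) * (x + of_nat k + 1) * conv_term x n n k * q (Suc k)"
    and "G (Suc k) - G k = conv_term x n n k *
      ((of_nat n - of_nat k) * (x + of_nat k + 1) * q (Suc k)
        - of_nat k * (2 * of_nat n + 1 - of_nat k) * q k)"
proof -
  show 1: "G (Suc k) = (of_nat n - of_nat k) * (x + of_nat k + 1) * conv_term x n n k * q (Suc k)"
    using conv_term_Suc_Suc[of k x n n] unfolding G_def of_nat_Suc by algebra
  have "(2 * of_nat n + 1 - of_nat k) * conv_term x n n k
      = (of_nat n + 1 - of_nat k) * conv_term x n (Suc n) k"
    using conv_term_Suc_right[of n n k x] by (simp add: algebra_simps)
  then have 2: "G k = of_nat k * (2 * of_nat n + 1 - of_nat k) * conv_term x n n k * q k"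
    unfolding G_def by (simp only: mult.assoc)
  show "G (Suc k) - G k = conv_term x n n k *
      ((of_nat n - of_nat k) * (x + of_nat k + 1) * q (Suc k)
        - of_nat k * (2 * of_nat n + 1 - of_nat k) * q k)"
    unfolding 1 2 by (simp add: algebra_simps)
qed

lemma sum_conv_term_weight:
  fixes q :: "nat \<Rightarrow> complex"
  shows "(\<Sum>k\<le>n. conv_term x n n k * ((of_nat n - of_nat k) * (x + of_nat k + 1) * q (Suc k)
        - of_nat k * (2 * of_nat n + 1 - of_nat k) * q k)) = 0"
proof -
  define G where
    "G k = of_nat k * (of_nat n + 1 - of_nat k) * conv_term x n (Suc n) k * q k" for k
  have "(\<Sum>k<Suc n. G (Suc k) - G k) = 0"
    unfolding sum_lessThan_telescope by (simp add: G_def)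
  then show ?thesis
    unfolding G_def conv_term_weight_telescope(2) lessThan_Suc_atMost .
qed

text \<open>The factor x + k + 1 of G(k + 1) cancels one power of the squared denominator, so for
  polynomial q a division with remainder by x + k + 1 removes all harmonic numbers from the right
  side.\<close>

lemma sum_conv_term_weight_harm:
  fixes q :: "nat \<Rightarrow> complex"
  assumes "\<And>k. k \<le> n \<Longrightarrow> x + of_nat k + 1 \<noteq> 0"
  shows "(\<Sum>k\<le>n. gen_harm 2 k x * (conv_term x n n k *
        ((of_nat n - of_nat k) * (x + of_nat k + 1) * q (Suc k)
        - of_nat k * (2 * of_nat n + 1 - of_nat k) * q k)))
    = - (\<Sum>k\<le>n. (of_nat n - of_nat k) * q (Suc k) * (conv_term x n n k / (x + of_nat k + 1)))"
proof -
  define G where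
    "G k = of_nat k * (of_nat n + 1 - of_nat k) * conv_term x n (Suc n) k * q k" for k
  have "(\<Sum>k<Suc n. gen_harm 2 k x * (G (Suc k) - G k))
      = - (\<Sum>k<Suc n. G (Suc k) / (x + of_nat k + 1) ^ 2)"
    unfolding gen_harm_sum_by_parts by (simp add: G_def)
  also have "(\<Sum>k<Suc n. G (Suc k) / (x + of_nat k + 1) ^ 2)
      = (\<Sum>k\<le>n. (of_nat n - of_nat k) * q (Suc k) * (conv_term x n n k / (x + of_nat k + 1)))"
    unfolding lessThan_Suc_atMost
  proof (rule sum.cong[OF refl])
    fix k assume "k \<in> {..n}"
    then have "x + of_nat k + 1 \<noteq> 0"
      using assms by simp
    then show "G (Suc k) / (x + of_nat k + 1) ^ 2
        = (of_nat n - of_nat k) * q (Suc k) * (conv_term x n n k / (x + of_nat k + 1))"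
      unfolding G_def conv_term_weight_telescope(1)
      by (simp add: power2_eq_square)
  qed
  finally show ?thesis
    unfolding G_def conv_term_weight_telescope(2) lessThan_Suc_atMost .
qed

section \<open>Elimination of the lower moments and the closed form\<close>

theorem theorem6:
  fixes x :: complex and n :: nat
  assumes "n \<ge> 2"
    and "\<forall>k\<in>{1..2 * n + 1}. x + of_nat k \<noteq> 0"
    and "\<forall>k\<in>{1..n}. x / 2 + of_nat k \<noteq> 0"
    and "\<forall>k\<in>{1..n + 1}. (x - 1) / 2 + of_nat k \<noteq> 0"
    and "of_nat n * (x + 1) * (x * of_nat n + 3 * of_nat n + 1) \<noteq> 0"
  shows "(\<Sum>k=0..n. of_nat ((2 * n - k) choose n) * ((x + of_nat k) gchoose k)
            * of_nat k ^ 2 * gen_harm 2 k x)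
    = (x + 1) * (x * of_nat n + 3 * of_nat n + 1) / (8 * (of_nat n - 1))
        * ((x + 2 * of_nat n + 1) gchoose (n - 2))
        * (4 * gen_harm 2 (2 * n + 1) x
           + 8 * (x ^ 2 + 3 * x + of_nat n ^ 2 - of_nat n + 1)
               / (of_nat n * (x + 1) * (x * of_nat n + 3 * of_nat n + 1))
           - (gen_harm 1 n (x / 2) - gen_harm 1 (n + 1) ((x - 1) / 2))
             * (gen_harm 1 n (x / 2) - gen_harm 1 (n + 1) ((x - 1) / 2)
                - 4 * (x + of_nat n + 1) * (x ^ 2 + 3 * x - 2 * of_nat n + 1)
                    / (of_nat n * (x + 1) * (x * of_nat n + 3 * of_nat n + 1))))"
proof -
  define v :: complex where "v = of_nat n"
  define d where "d = alt_harm x n"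
  define h where "h = gen_harm 2 (2 * n + 1) x"
  define S where "S = ((x + 2 * v + 1) gchoose n)"
  define B where "B = ((x + 2 * v + 1) gchoose (n - 2))"
  define P where "P = x * v + 3 * v + 1"
  define f where "f k = conv_term x n n k" for k
  define K where "K = (\<Sum>k\<le>n. of_nat k * f k)"
  define E where "E = (\<Sum>k\<le>n. f k / (x + of_nat k + 1))"
  define A where "A i = (\<Sum>k\<le>n. of_nat k ^ i * f k * gen_harm 2 k x)" for i :: nat
  \<comment> \<open>Here n >= 2 matters: it puts n + 3 into the range 1, ..., 2n + 1.\<close>
  have nz: "x + v + 2 \<noteq> 0" "x + v + 3 \<noteq> 0"
    using assms(1) assms(2)[rule_format, of "n + 2"] assms(2)[rule_format, of "n + 3"]
    by (auto simp: v_def algebra_simps)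
  have nz': "v \<noteq> 0" "v - 1 \<noteq> 0" "x + 1 \<noteq> 0" "P \<noteq> 0"
    using assms(1) assms(5) by (auto simp: v_def P_def)
  have xk: "x + of_nat k + 1 \<noteq> 0" if "k \<le> n" for k
    using assms(2)[rule_format, of "Suc k"] that by (simp add: algebra_simps)
  have S: "(\<Sum>k\<le>n. f k) = S"
    unfolding f_def S_def v_def by (rule sum_conv_term_diag)
  have E: "E = - S * d / 2"
    unfolding E_def f_def S_def v_def d_def using assms(2) by (intro sum_conv_term_divide) blast
  have A0: "A 0 = S * (4 * h - d ^ 2) / 8"
    unfolding A_def f_def S_def v_def d_def h_def
    using sum_conv_term_harm[of n x] assms(2) by simp
  \<comment> \<open>For q = 1 the quadratic terms of the weight cancel, leaving v (x+1) - (x+v+2)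
    k.\<close>
  have K: "(x + v + 2) * K = v * (x + 1) * S"
  proof -
    have "(\<Sum>k\<le>n. f k * (v * (x + 1) - (x + v + 2) * of_nat k)) = 0"
      using sum_conv_term_weight[of x n "\<lambda>_. 1"] unfolding f_def v_def
      by (simp add: algebra_simps)
    moreover have "(\<Sum>k\<le>n. f k * (v * (x + 1) - (x + v + 2) * of_nat k))
        = v * (x + 1) * S - (x + v + 2) * K"
      unfolding K_def S[symmetric] sum_distrib_left sum_subtractf[symmetric]
      by (rule sum.cong) (simp_all add: algebra_simps)
    ultimately show ?thesis by simp
  qed
  \<comment> \<open>The same weight with harmonic numbers; the remainder is split by -(v-k) =
    (x+k+1) - (x+v+1).\<close>
  have A1: "v * (x + 1) * A 0 - (x + v + 2) * A 1 = S - (x + v + 1) * E"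
  proof -
    have "v * (x + 1) * A 0 - (x + v + 2) * A 1
       = (\<Sum>k\<le>n. gen_harm 2 k x * (f k *
        ((of_nat n - of_nat k) * (x + of_nat k + 1) * 1
        - of_nat k * (2 * of_nat n + 1 - of_nat k) * 1)))"
      unfolding A_def sum_distrib_left sum_subtractf[symmetric]
      by (rule sum.cong) (simp_all add: v_def algebra_simps)
    also have "\<dots> = - (\<Sum>k\<le>n. (v - of_nat k) * 1 * (f k / (x + of_nat k + 1)))"
      unfolding f_def v_def by (rule sum_conv_term_weight_harm) (rule xk)
    also have "\<dots> = S - (x + v + 1) * E"
      unfolding S[symmetric] E_def sum_distrib_left sum_subtractf[symmetric] sum_negf[symmetric]
    proof (rule sum.cong[OF refl])
      fix k assume "k \<in> {..n}"
      then have "x + of_nat k + 1 \<noteq> 0" using xk by simp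
      then have "f k = (x + of_nat k + 1) * (f k / (x + of_nat k + 1))" by simp
      then show "- ((v - of_nat k) * 1 * (f k / (x + of_nat k + 1)))
          = f k - (x + v + 1) * (f k / (x + of_nat k + 1))"
        by algebra
    qed
    finally show ?thesis .
  qed
  \<comment> \<open>For q(k) = k the cubic terms cancel. On the right, -(v-k)(k+1) = (x+k+1)(k-x-v)
    + x (x+v+1).\<close>
  have A2: "v * (x + 1) * A 0 + (v * (x + 2) - (x + 1)) * A 1 - (x + v + 3) * A 2
      = K - (x + v) * S + x * (x + v + 1) * E"
  proof -
    have "v * (x + 1) * A 0 + (v * (x + 2) - (x + 1)) * A 1 - (x + v + 3) * A 2
       = (\<Sum>k\<le>n. gen_harm 2 k x * (f k *
        ((of_nat n - of_nat k) * (x + of_nat k + 1) * of_nat (Suc k)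
        - of_nat k * (2 * of_nat n + 1 - of_nat k) * of_nat k)))"
      unfolding A_def sum_distrib_left sum_subtractf[symmetric] sum.distrib[symmetric]
      by (rule sum.cong) (simp_all add: v_def algebra_simps power2_eq_square)
    also have "\<dots> = - (\<Sum>k\<le>n. (v - of_nat k) * of_nat (Suc k) * (f k / (x + of_nat k + 1)))"
      unfolding f_def v_def by (rule sum_conv_term_weight_harm) (rule xk)
    also have "\<dots> = K - (x + v) * S + x * (x + v + 1) * E"
      unfolding S[symmetric] E_def K_def sum_distrib_left sum_subtractf[symmetric]
        sum_negf[symmetric] sum.distrib[symmetric]
    proof (rule sum.cong[OF refl])
      fix k assume "k \<in> {..n}"
      then have "x + of_nat k + 1 \<noteq> 0" using xk by simp
      then have "f k = (x + of_nat k + 1) * (f k / (x + of_nat k + 1))" by simp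
      then show "- ((v - of_nat k) * of_nat (Suc k) * (f k / (x + of_nat k + 1)))
          = of_nat k * f k - (x + v) * f k + x * (x + v + 1) * (f k / (x + of_nat k + 1))"
        unfolding of_nat_Suc by algebra
    qed
    finally show ?thesis .
  qed
  \<comment> \<open>Lowering the bottom index twice produces the same factor (x+v+3)(x+v+2) that
    eliminating A 1 and K introduces, so it cancels at the end.\<close>
  have SB: "v * (v - 1) * S = (x + v + 3) * (x + v + 2) * B"
  proof -
    obtain m where m: "n = Suc (Suc m)"
      using assms(1) by (metis add_2_eq_Suc le_Suc_ex)
    define y where "y = x + 2 * v + 1"
    define W where "W = (y gchoose Suc m)"
    have B: "B = (y gchoose m)" and S: "S = (y gchoose Suc (Suc m))"
      and v: "of_nat m = v - 2"
      by (simp_all add: B_def S_def y_def m v_def)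
    have 1: "(v - 1) * W = (x + v + 3) * B"
      using gbinomial_mult_1[of y m] unfolding B W_def of_nat_Suc v y_def
      by (simp add: algebra_simps)
    have 2: "v * S = (x + v + 2) * W"
      using gbinomial_mult_1[of y "Suc m"] unfolding S W_def of_nat_Suc v y_def
      by (simp add: algebra_simps)
    have "v * (v - 1) * S = (v - 1) * (v * S)"
      by (simp only: mult_ac)
    also have "\<dots> = (x + v + 2) * ((v - 1) * W)"
      unfolding 2 by (simp only: mult_ac)
    finally show ?thesis
      unfolding 1 by (simp only: mult_ac)
  qed
  define Y where "Y = x ^ 2 + 3 * x + v ^ 2 - v + 1"
  define Z where "Z = (x + v + 1) * (x ^ 2 + 3 * x - 2 * v + 1)"
  define r where "r = v * (x + 1) * P"
  define c where "c = (x + v + 3) * (x + v + 2)"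
  have "8 * c * A 2 = S * (r * (4 * h - d ^ 2) + 8 * Y + 4 * d * Z)"
  proof -
    define a where "a = v * (x + 2) - (x + 1)"
    have "8 * c * A 2
        = 8 * (x + v + 2) * (v * (x + 1) * A 0 - K + (x + v) * S - x * (x + v + 1) * E)
          + 8 * a * ((x + v + 2) * A 1)"
    proof -
      have "(x + v + 3) * A 2
          = v * (x + 1) * A 0 + a * A 1 - (K - (x + v) * S + x * (x + v + 1) * E)"
        using A2 unfolding a_def by (simp add: algebra_simps)
      then have "8 * (x + v + 2) * ((x + v + 3) * A 2)
          = 8 * (x + v + 2) * (v * (x + 1) * A 0 + a * A 1 - (K - (x + v) * S + x * (x + v + 1) * E))"
        by simp
      then show ?thesis
        unfolding c_def by (simp add: algebra_simps)
    qed
    also have "(x + v + 2) * A 1 = v * (x + 1) * A 0 - S + (x + v + 1) * E"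
      using A1 by (simp add: algebra_simps)
    also have "8 * (x + v + 2) * (v * (x + 1) * A 0 - K + (x + v) * S - x * (x + v + 1) * E)
        = 8 * (x + v + 2) * (v * (x + 1) * A 0 + (x + v) * S - x * (x + v + 1) * E)
          - 8 * ((x + v + 2) * K)"
      by (simp add: algebra_simps)
    finally have step: "8 * c * A 2
        = 8 * (x + v + 2) * (v * (x + 1) * A 0 + (x + v) * S - x * (x + v + 1) * E)
          - 8 * ((x + v + 2) * K) + 8 * a * (v * (x + 1) * A 0 - S + (x + v + 1) * E)" .
    \<comment> \<open>With d / 2 and A 0 / S abbreviated, what remains is a polynomial identity free
      of fractions.\<close>
    define e where "e = d / 2"
    define b where "b = (4 * h - d ^ 2) / 8"
    have E': "E = - (S * e)" and A0': "A 0 = S * b"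
      by (simp_all add: E A0 e_def b_def)
    have "8 * c * A 2 = S * (r * (8 * b) + 8 * Y + 8 * e * Z)"
      unfolding step K A0' E' r_def P_def Y_def Z_def a_def
      by (simp add: algebra_simps power2_eq_square)
    then show ?thesis
      by (simp add: e_def b_def)
  qed
  then have "v * (v - 1) * (8 * c * A 2)
      = (v * (v - 1) * S) * (r * (4 * h - d ^ 2) + 8 * Y + 4 * d * Z)"
    by (simp only: mult.assoc)
  then have "c * (8 * v * (v - 1) * A 2) = c * (B * (r * (4 * h - d ^ 2) + 8 * Y + 4 * d * Z))"
    unfolding SB c_def[symmetric] by (simp only: mult_ac)
  moreover have "c \<noteq> 0"
    using nz by (simp add: c_def)
  ultimately have "8 * v * (v - 1) * A 2 = B * (r * (4 * h - d ^ 2) + 8 * Y + 4 * d * Z)"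
    by (simp only: mult_cancel_left) blast
  then have "A 2 = B * (r * (4 * h - d ^ 2) + 8 * Y + 4 * d * Z) / (8 * v * (v - 1))"
    using nz' by (simp add: eq_divide_eq mult_ac)
  also have "r * (4 * h - d ^ 2) + 8 * Y + 4 * d * Z
      = r * (4 * h + 8 * Y / r - d * (d - 4 * Z / r))"
  proof -
    have "r \<noteq> 0"
      using nz' by (simp add: r_def)
    then show ?thesis
      by (simp add: field_simps power2_eq_square)
  qed
  also have "B * (r * (4 * h + 8 * Y / r - d * (d - 4 * Z / r))) / (8 * v * (v - 1))
      = (x + 1) * P / (8 * (v - 1)) * B * (4 * h + 8 * Y / r - d * (d - 4 * Z / r))"
    using nz' unfolding r_def by (simp add: mult_ac)
  finally have "A 2 = (x + 1) * P / (8 * (v - 1)) * B * (4 * h + 8 * Y / r - d * (d - 4 * Z / r))" .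
  moreover have "A 2 = (\<Sum>k=0..n. of_nat ((2 * n - k) choose n) * ((x + of_nat k) gchoose k)
            * of_nat k ^ 2 * gen_harm 2 k x)"
    unfolding A_def f_def atLeast0AtMost
    by (rule sum.cong) (simp_all add: conv_term_def mult_2[symmetric] mult_ac)
  ultimately show ?thesis
    unfolding P_def B_def h_def d_def Y_def Z_def r_def v_def alt_harm_def
    by (simp only: mult.assoc)
qed

end
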